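(* Let $f(x)=a_nx^n+\dots+a_1x+a_0$ be a polynomial of degree $n\ge 1$ with real coefficients $a_0,\dots,a_n\in\mathbb{R}$, $a_n\neq 0$, and $a_0>0$. For $1\le k\le n$ and each sign $\pm$, let $D_k^\pm(f)$ be the determinant of the $k\times k$ matrix whose $(i,j)$ entry ($1\le i,j\le k$) is \[ d_{ij}=a_{j-i}\pm a_{i+j+n-k-1}, \] with the convention $a_m=0$ for $m<0$ and $m>n$. Then: 1. $f$ is expansive if and only if $D_k^+(f)>0$ and $D_k^-(f)>0$ for all $1\le k\le n$. 2. $f$ is expansive if and only if $D_k^+(f)>0$ and $D_k^-(f)>0$ for all $1\le k\le n-1$, and $f(1)>0$ and $f(-1)>0$. 3. Moreover, $f$ is expansive if and only if $D_k^+(f)>0$ and $D_k^-(f)>0$ for all $k\in\{n,n-2,n-4,\dots\}$ with $k\ge 1$; and $f$ is expansive if and only if $D_k^+(f)>0$ and $D_k^-(f)>0$ for all $k\in\{n-1,n-3,n-5,\dots\}$ with $k\ge1$, together with $f(1)>0$ and $f(-1)>0$.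
   Context: A polynomial is called expansive if all of its complex roots $\alpha$ satisfy $|\alpha|>1$. *)

theory Defs
  imports Complex_Main "Jordan_Normal_Form.Determinant"
begin

definition expansive :: "real poly \<Rightarrow> bool" where
  "expansive f \<longleftrightarrow>
     (\<forall>\<alpha>::complex. poly (map_poly complex_of_real f) \<alpha> = 0 \<longrightarrow> cmod \<alpha> > 1)"

(* For m > degree f the coefficient is already 0 in the library. *)
definition icoeff :: "real poly \<Rightarrow> int \<Rightarrow> real" where
  "icoeff f m = (if m < 0 then 0 else coeff f (nat m))"

definition d_entry :: "real \<Rightarrow> real poly \<Rightarrow> nat \<Rightarrow> nat \<Rightarrow> nat \<Rightarrow> real" where
  "d_entry s f k i j =
     icoeff f (int j - int i) +
     s * icoeff f (int i + int j + int (degree f) - int k - 1)"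

(* The rows and columns of a library matrix are counted from 0,
   those of d_entry from 1, hence the shift by one. *)
definition D_mat :: "real \<Rightarrow> real poly \<Rightarrow> nat \<Rightarrow> real mat" where
  "D_mat s f k = mat k k (\<lambda>(i, j). d_entry s f k (i + 1) (j + 1))"

definition D_plus :: "nat \<Rightarrow> real poly \<Rightarrow> real" where
  "D_plus k f = det (D_mat 1 f k)"

definition D_minus :: "nat \<Rightarrow> real poly \<Rightarrow> real" where
  "D_minus k f = det (D_mat (-1) f k)"

end

theory Submission
  imports Defs "HOL-Computational_Algebra.Fundamental_Theorem_Algebra"
begin

text \<open>
  Treat \<open>f\<close> as a polynomial of formal degree \<open>n\<close>, let \<open>f\<^sup>*(x) = x\<^sup>n f(1/x)\<close> and take the
  Schur transform \<open>g = a\<^sub>0 f - a\<^sub>n f\<^sup>*\<close>, of formal degree \<open>n - 1\<close>. If \<open>|a\<^sub>n| < a\<^sub>0\<close>, then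
  \<open>f\<close> is expansive iff \<open>g\<close> is, because \<open>|f\<^sup>*| \<le> |f|\<close> on the closed unit disc for expansive \<open>f\<close>.
  With \<open>J\<close> the exchange matrix, the matrix of \<open>D\<^sub>k\<^sup>\<plusminus>(g)\<close>, formed with formal degree \<open>n\<close>, is
  that of \<open>D\<^sub>k\<^sup>\<plusminus>(f)\<close> times \<open>a\<^sub>0 I \<minusplus> a\<^sub>n J\<close>, and its last row is \<open>(0, \<dots>, 0, g(0))\<close>. Hence
  \<open>D\<^sub>k\<^sup>\<plusminus>(f)\<close> and \<open>D\<^bsub>k-1\<^esub>\<^sup>\<plusminus>(g)\<close>, the latter with formal degree \<open>n - 1\<close>, have the same sign,
  and induction on \<open>n\<close> applies. The condition \<open>|a\<^sub>n| < a\<^sub>0\<close> follows from \<open>D\<^sub>1\<^sup>\<plusminus> > 0\<close> as well as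
  from \<open>D\<^sub>2\<^sup>\<plusminus> > 0\<close>, which is why every second \<open>k\<close> suffices.
\<close>

section \<open>Reciprocal polynomials and the Schur transform\<close>

text \<open>\<open>reflect_poly\<close> reverses at the actual degree; the power of \<open>x\<close>
  shifts the result to formal degree \<open>n\<close>. Formal degrees are needed because a Schur
  transform may drop in degree by more than one.\<close>

definition reciprocal_poly :: "nat \<Rightarrow> 'a::comm_semiring_1 poly \<Rightarrow> 'a poly" where
  "reciprocal_poly n f = monom 1 (n - degree f) * reflect_poly f"

lemma coeff_reciprocal_poly:
  assumes "degree f \<le> n"
  shows "coeff (reciprocal_poly n f) i = (if i \<le> n then coeff f (n - i) else 0)"
  using assms by (auto simp: reciprocal_poly_def coeff_monom_mult coeff_reflect_poly
      intro!: arg_cong[where f = "coeff f"] coeff_eq_0)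

lemma icoeff_reciprocal_poly:
  assumes "degree f \<le> n"
  shows "icoeff (reciprocal_poly n f) m = icoeff f (int n - m)"
  using assms
  by (auto simp: icoeff_def coeff_reciprocal_poly nat_diff_distrib intro!: coeff_eq_0)

definition schur_transform :: "nat \<Rightarrow> real poly \<Rightarrow> real poly" where
  "schur_transform n f =
     smult (coeff f 0) f - smult (coeff f n) (reciprocal_poly n f)"

lemma icoeff_schur_transform:
  assumes "degree f \<le> n"
  shows "icoeff (schur_transform n f) m
       = coeff f 0 * icoeff f m - coeff f n * icoeff f (int n - m)"
proof -
  have "icoeff (schur_transform n f) m
      = coeff f 0 * icoeff f m - coeff f n * icoeff (reciprocal_poly n f) m"
    by (simp add: icoeff_def schur_transform_def)
  then show ?thesis
    using assms by (simp add: icoeff_reciprocal_poly)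
qed

lemma coeff_0_schur_transform:
  assumes "degree f \<le> n"
  shows "coeff (schur_transform n f) 0 = (coeff f 0)\<^sup>2 - (coeff f n)\<^sup>2"
  using icoeff_schur_transform[OF assms, of 0] by (simp add: icoeff_def power2_eq_square)

lemma degree_schur_transform:
  assumes "degree f \<le> Suc n"
  shows "degree (schur_transform (Suc n) f) \<le> n"
proof (rule degree_le, intro allI impI)
  fix i assume "n < i"
  then show "coeff (schur_transform (Suc n) f) i = 0"
    using assms
    by (cases "i = Suc n")
      (auto simp: schur_transform_def coeff_reciprocal_poly coeff_eq_0)
qed

lemma coeff_0_schur_transform_pos:
  assumes "degree f \<le> n" and "\<bar>coeff f n\<bar> < coeff f 0"
  shows "coeff (schur_transform n f) 0 > 0"
proof -
  have "(coeff f n)\<^sup>2 < (coeff f 0)\<^sup>2"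
    using assms(2) abs_le_square_iff[of "coeff f 0" "coeff f n"] by linarith
  then show ?thesis
    using assms(1) by (simp add: coeff_0_schur_transform)
qed

text \<open>Reversal at a fixed formal degree is an involution, so the reciprocal of the transform
  is again a combination of \<open>f\<close> and its reciprocal; the weights are chosen to cancel
  the latter. This recovers \<open>f\<close> from its transform.\<close>

lemma reciprocal_poly_schur_transform:
  assumes "degree f \<le> Suc n"
  shows "smult (coeff f 0) (schur_transform (Suc n) f)
           + smult (coeff f (Suc n)) (reciprocal_poly (Suc n) (schur_transform (Suc n) f))
       = smult ((coeff f 0)\<^sup>2 - (coeff f (Suc n))\<^sup>2) f"
proof (rule poly_eqI)
  fix i
  have "degree (schur_transform (Suc n) f) \<le> Suc n"
    using degree_schur_transform[OF assms] by simp
  then show "coeff (smult (coeff f 0) (schur_transform (Suc n) f)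
           + smult (coeff f (Suc n)) (reciprocal_poly (Suc n) (schur_transform (Suc n) f))) i
       = coeff (smult ((coeff f 0)\<^sup>2 - (coeff f (Suc n))\<^sup>2) f) i"
    using assms
    by (auto simp: coeff_reciprocal_poly schur_transform_def power2_eq_square algebra_simps
        coeff_eq_0)
qed

lemma poly_reciprocal_poly_sign:
  fixes f :: "real poly"
  assumes "s = 1 \<or> s = -1"
  shows "poly (reciprocal_poly n f) s = s ^ (n - degree f) * s ^ degree f * poly f s"
  using assms by (auto simp: reciprocal_poly_def poly_monom poly_reflect_poly_nz)

text \<open>At \<open>s\<close> = 1 or -1 the reciprocal takes the value
  \<open>s ^ n * poly f s\<close>, so the transform merely scales \<open>poly f s\<close> by a
  positive factor.\<close>

lemma poly_schur_transform_pos: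
  assumes "s = 1 \<or> s = -1" and "degree f \<le> n"
    and "\<bar>coeff f n\<bar> < coeff f 0" and "poly f s > 0"
  shows "poly (schur_transform n f) s > 0"
proof -
  have "poly (schur_transform n f) s = (coeff f 0 - coeff f n * s ^ n) * poly f s"
    using assms(2) poly_reciprocal_poly_sign[OF assms(1), of n f]
    by (simp add: schur_transform_def algebra_simps flip: power_add)
  moreover have "\<bar>s ^ n\<bar> = 1"
    using assms(1) by (auto simp: power_abs)
  then have "\<bar>coeff f n * s ^ n\<bar> = \<bar>coeff f n\<bar>"
    by (simp add: abs_mult)
  then have "coeff f 0 - coeff f n * s ^ n > 0"
    using assms(3) by linarith
  ultimately show ?thesis
    using assms(4) by simp
qed

section \<open>Expansive polynomials\<close>

text \<open>The Blaschke factor estimate, for a single root: the difference of the squared moduli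
  factors.\<close>

lemma cmod_reflect_linear_le:
  assumes "cmod z \<le> 1" and "cmod \<alpha> > 1"
  shows "cmod (1 - \<alpha> * z) \<le> cmod (cnj z - \<alpha>)"
proof -
  have "(cmod (cnj z - \<alpha>))\<^sup>2 - (cmod (1 - \<alpha> * z))\<^sup>2 = ((cmod \<alpha>)\<^sup>2 - 1) * (1 - (cmod z)\<^sup>2)"
    unfolding cmod_power2 by (simp add: power2_eq_square algebra_simps)
  also have "\<dots> \<ge> 0"
    using assms by (intro mult_nonneg_nonneg) (auto simp: power_le_one abs_square_le_1)
  finally have "(cmod (1 - \<alpha> * z))\<^sup>2 \<le> (cmod (cnj z - \<alpha>))\<^sup>2"
    by linarith
  then show ?thesis
    by (rule power2_le_imp_le) simp
qed

lemma reflect_poly_linear: "reflect_poly [:- \<alpha>, 1:] = [:1, - \<alpha> :: complex:]"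
  by (simp add: reflect_poly_def cCons_def)

text \<open>Evaluating \<open>p\<close> at \<open>cnj z\<close> avoids conjugating the coefficients of the reciprocal.\<close>

lemma expansive_reflect_poly_bounds:
  fixes p :: "complex poly"
  assumes "\<And>\<alpha>. poly p \<alpha> = 0 \<Longrightarrow> cmod \<alpha> > 1"
  shows "(\<forall>z. cmod z \<le> 1 \<longrightarrow> cmod (poly (reflect_poly p) z) \<le> cmod (poly p (cnj z)))
       \<and> (degree p > 0 \<longrightarrow> cmod (lead_coeff p) < cmod (coeff p 0))"
  using assms
proof (induction "degree p" arbitrary: p)
  case 0
  then obtain c where "p = [:c:]"
    by (metis degree_eq_zeroE)
  then show ?case
    by simp
next
  case (Suc d)
  have "\<not> constant (poly p)"
    using Suc.hyps(2) by (simp add: constant_degree)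
  then obtain \<alpha> where root: "poly p \<alpha> = 0"
    using fundamental_theorem_of_algebra by blast
  then obtain q where p: "p = [:- \<alpha>, 1:] * q"
    by (auto simp: poly_eq_0_iff_dvd elim: dvdE)
  have \<alpha>: "cmod \<alpha> > 1"
    using Suc.prems root by blast
  have "q \<noteq> 0"
    using Suc.hyps(2) p by auto
  then have "degree p = Suc (degree q)"
    unfolding p by (subst degree_mult_eq) auto
  then have "d = degree q"
    using Suc.hyps(2) by simp
  moreover have q_roots: "cmod \<beta> > 1" if "poly q \<beta> = 0" for \<beta>
    using Suc.prems[of \<beta>] that p by simp
  ultimately have le: "cmod (poly (reflect_poly q) z) \<le> cmod (poly q (cnj z))"
    if "cmod z \<le> 1" for z
    using Suc.hyps(1)[of q] that by blast
  have "cmod (poly (reflect_poly p) z) \<le> cmod (poly p (cnj z))" if z: "cmod z \<le> 1" for z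
  proof -
    have "poly (reflect_poly p) z = (1 - \<alpha> * z) * poly (reflect_poly q) z"
      unfolding p reflect_poly_mult reflect_poly_linear by (simp add: algebra_simps)
    moreover have "poly p (cnj z) = (cnj z - \<alpha>) * poly q (cnj z)"
      unfolding p by (simp add: algebra_simps)
    ultimately show ?thesis
      using mult_mono[OF cmod_reflect_linear_le[OF z \<alpha>] le[OF z]] by (simp add: norm_mult)
  qed
  moreover have "cmod (lead_coeff p) < cmod (coeff p 0)"
  proof -
    have "cmod (coeff q 0) > 0"
      using q_roots[of 0] by (auto simp: poly_0_coeff_0)
    then have "cmod (coeff q 0) < cmod \<alpha> * cmod (coeff q 0)"
      using \<alpha> by simp
    \<comment> \<open>The disc bound at 0, where the reflected polynomial takes the value
      \<open>lead_coeff q\<close>. Strictness comes from the split-off root \<alpha>.\<close>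
    moreover have "cmod (lead_coeff q) \<le> cmod (coeff q 0)"
      using le[of 0] by (simp add: poly_0_coeff_0)
    moreover have "lead_coeff p = lead_coeff q"
      unfolding p lead_coeff_mult by simp
    moreover have "coeff p 0 = - \<alpha> * coeff q 0"
      unfolding p by (simp add: coeff_mult)
    ultimately show ?thesis
      by (simp add: norm_mult)
  qed
  ultimately show ?case
    by blast
qed

section \<open>Real polynomials viewed over the complex numbers\<close>

abbreviation cpoly :: "real poly \<Rightarrow> complex poly" where
  "cpoly \<equiv> map_poly complex_of_real"

lemma expansiveI:
  assumes "\<And>z. cmod z \<le> 1 \<Longrightarrow> poly (cpoly f) z \<noteq> 0"
  shows "expansive f"
  using assms unfolding expansive_def by (meson not_le)

lemma cpoly_simps:
  "cpoly (p + q) = cpoly p + cpoly q"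
  "cpoly (p - q) = cpoly p - cpoly q"
  "cpoly (smult c p) = smult (complex_of_real c) (cpoly p)"
  by (simp_all add: poly_eq_iff coeff_map_poly)

lemma cpoly_reciprocal_poly: "cpoly (reciprocal_poly n f) = reciprocal_poly n (cpoly f)"
proof -
  have deg: "degree (cpoly f) = degree f"
    by (rule degree_map_poly) simp
  then show ?thesis
    by (auto simp: poly_eq_iff coeff_map_poly reciprocal_poly_def coeff_monom_mult
        coeff_reflect_poly)
qed

lemma poly_cpoly_cnj: "poly (cpoly f) (cnj z) = cnj (poly (cpoly f) z)"
  by (induction f) (simp_all add: map_poly_pCons)

text \<open>Real coefficients make the conjugation invisible to the modulus, and the extra power of
  \<open>z\<close> only shrinks the left side.\<close>

lemma expansive_reciprocal_poly_le:
  assumes "expansive f" and "cmod z \<le> 1"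
  shows "cmod (poly (cpoly (reciprocal_poly n f)) z) \<le> cmod (poly (cpoly f) z)"
proof -
  have "cmod (poly (reflect_poly (cpoly f)) z) \<le> cmod (poly (cpoly f) (cnj z))"
    using expansive_reflect_poly_bounds[of "cpoly f"] assms by (auto simp: expansive_def)
  moreover have "cmod z ^ m * x \<le> x" if "x \<ge> 0" for m x
    using assms(2) that by (intro mult_left_le_one_le) (auto simp: power_le_one)
  then have "cmod (poly (cpoly (reciprocal_poly n f)) z) \<le> cmod (poly (reflect_poly (cpoly f)) z)"
    unfolding cpoly_reciprocal_poly
    by (simp add: reciprocal_poly_def norm_mult norm_power poly_monom)
  ultimately show ?thesis
    by (simp add: poly_cpoly_cnj)
qed

lemma expansive_coeff_less:
  assumes "expansive f" and "degree f \<le> Suc n" and "coeff f 0 > 0"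
  shows "\<bar>coeff f (Suc n)\<bar> < coeff f 0"
proof (cases "degree f = Suc n")
  case True
  have "degree (cpoly f) = degree f"
    by (rule degree_map_poly) simp
  then show ?thesis
    using expansive_reflect_poly_bounds[of "cpoly f"] assms True
    by (auto simp: expansive_def coeff_map_poly)
next
  case False
  then show ?thesis
    using assms by (simp add: coeff_eq_0)
qed

text \<open>A Rouche-type perturbation: the first summand dominates the second on the unit disc.\<close>

lemma expansive_perturb:
  assumes "expansive f" and "\<bar>b\<bar> < a"
  shows "expansive (smult a f + smult b (reciprocal_poly n f))"
proof (rule expansiveI)
  fix z assume z: "cmod z \<le> 1"
  let ?F = "poly (cpoly f) z" and ?R = "poly (cpoly (reciprocal_poly n f)) z"
  have "?F \<noteq> 0"
    using assms(1) z unfolding expansive_def by force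
  have "cmod (complex_of_real b * ?R) \<le> \<bar>b\<bar> * cmod ?F"
    using expansive_reciprocal_poly_le[OF assms(1) z]
    by (simp add: norm_mult mult_left_mono)
  also have "\<dots> < a * cmod ?F"
    using assms(2) \<open>?F \<noteq> 0\<close> by simp
  also have "\<dots> = cmod (complex_of_real a * ?F)"
    using assms(2) by (simp add: norm_mult)
  finally have "complex_of_real a * ?F + complex_of_real b * ?R \<noteq> 0"
    by (metis add_eq_0_iff norm_minus_cancel less_irrefl)
  then show "poly (cpoly (smult a f + smult b (reciprocal_poly n f))) z \<noteq> 0"
    by (simp add: cpoly_simps)
qed

lemma expansive_smult: "c \<noteq> 0 \<Longrightarrow> expansive (smult c f) \<longleftrightarrow> expansive f"
  by (simp add: expansive_def cpoly_simps)

text \<open>Both directions are instances of \<open>expansive_perturb\<close>: the transform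
  perturbs \<open>f\<close>, and perturbing the transform gives back a nonzero multiple of
  \<open>f\<close>.\<close>

lemma expansive_schur_transform:
  assumes "degree f \<le> Suc n" and "\<bar>coeff f (Suc n)\<bar> < coeff f 0"
  shows "expansive (schur_transform (Suc n) f) \<longleftrightarrow> expansive f"
proof
  assume "expansive f"
  then show "expansive (schur_transform (Suc n) f)"
    using expansive_perturb[of f "- coeff f (Suc n)" "coeff f 0" "Suc n"] assms(2)
    by (simp add: schur_transform_def)
next
  assume "expansive (schur_transform (Suc n) f)"
  from expansive_perturb[OF this assms(2), of "Suc n"]
  have "expansive (smult ((coeff f 0)\<^sup>2 - (coeff f (Suc n))\<^sup>2) f)"
    using reciprocal_poly_schur_transform[OF assms(1)] by simp
  moreover have "(coeff f 0)\<^sup>2 - (coeff f (Suc n))\<^sup>2 \<noteq> 0"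
    using coeff_0_schur_transform_pos[OF assms] coeff_0_schur_transform[OF assms(1)] by simp
  ultimately show "expansive f"
    by (simp add: expansive_smult)
qed

lemma expansive_degree_0:
  assumes "degree f = 0" and "coeff f 0 > 0"
  shows "expansive f"
proof -
  obtain c where "f = [:c:]"
    using assms(1) by (rule degree_eq_zeroE)
  then show ?thesis
    using assms(2) by (simp add: expansive_def map_poly_pCons)
qed

text \<open>There is no root in [-1, 1] and the value at 0 is positive, so the intermediate value
  theorem forbids a sign change.\<close>

lemma expansive_poly_pos:
  assumes "expansive f" and "coeff f 0 > 0" and "s = 1 \<or> s = -1"
  shows "poly f s > 0"
proof (rule ccontr)
  have root: "poly f x \<noteq> 0" if "\<bar>x\<bar> \<le> 1" for x
  proof
    assume "poly f x = 0"
    moreover have "poly (cpoly f) (complex_of_real x) = complex_of_real (poly f x)"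
      by (induction f) (simp_all add: map_poly_pCons)
    ultimately have "cmod (complex_of_real x) > 1"
      using assms(1) unfolding expansive_def by (metis of_real_0)
    then show False
      using that by simp
  qed
  assume "\<not> poly f s > 0"
  then have "poly f s < 0"
    using root[of s] assms(3) by force
  moreover have "poly f 0 > 0"
    using assms(2) by (simp add: poly_0_coeff_0)
  ultimately obtain x where "\<bar>x\<bar> \<le> 1" "poly f x = 0"
    using assms(3) poly_IVT_neg[of 0 1 f] poly_IVT_pos[of "-1" 0 f] by force
  then show False
    using root by blast
qed

section \<open>The determinants for a formal degree\<close>

text \<open>Indices count from 0, which turns the offset -1 of \<open>d_entry\<close> into +1. The
  formal degree \<open>n\<close> replaces \<open>degree f\<close>.\<close>

definition formal_D_mat :: "real \<Rightarrow> real poly \<Rightarrow> nat \<Rightarrow> nat \<Rightarrow> real mat" where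
  "formal_D_mat s f n k =
     mat k k (\<lambda>(i, j). icoeff f (int j - int i) + s * icoeff f (int i + int j + int n + 1 - int k))"

lemma formal_D_mat_carrier: "formal_D_mat s f n k \<in> carrier_mat k k"
  by (simp add: formal_D_mat_def)

lemma D_mat_eq_formal: "D_mat s f k = formal_D_mat s f (degree f) k"
  by (rule eq_matI)
    (auto simp: D_mat_def formal_D_mat_def d_entry_def algebra_simps)

text \<open>This is \<open>a I + b J\<close> with \<open>J\<close> the exchange matrix. The two
  parts are added because diagonal and antidiagonal meet in the centre when \<open>k\<close> is
  odd.\<close>

definition exchange_comb :: "nat \<Rightarrow> real \<Rightarrow> real \<Rightarrow> real mat" where
  "exchange_comb k a b =
     mat k k (\<lambda>(i, j). (if i = j then a else 0) + (if i + j + 1 = k then b else 0))"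

lemma exchange_comb_carrier: "exchange_comb k a b \<in> carrier_mat k k"
  by (simp add: exchange_comb_def)

lemma index_mult_exchange_comb:
  assumes "A \<in> carrier_mat k k" and "i < k" and "j < k"
  shows "(A * exchange_comb k a b) $$ (i, j) = A $$ (i, j) * a + A $$ (i, k - 1 - j) * b"
proof -
  have "(A * exchange_comb k a b) $$ (i, j)
      = (\<Sum>l<k. A $$ (i, l) * ((if l = j then a else 0) + (if l = k - 1 - j then b else 0)))"
    using assms
    by (auto simp: exchange_comb_def scalar_prod_def atLeast0LessThan intro!: sum.cong)
  also have "\<dots> = (\<Sum>l<k. (if l = j then A $$ (i, l) * a else 0))
                + (\<Sum>l<k. (if l = k - 1 - j then A $$ (i, l) * b else 0))"
    by (subst sum.distrib[symmetric]) (auto intro!: sum.cong simp: algebra_simps)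
  also have "\<dots> = A $$ (i, j) * a + A $$ (i, k - 1 - j) * b"
    using assms by (simp add: sum.delta)
  finally show ?thesis .
qed

text \<open>Since \<open>J\<close> squares to the identity, these matrices multiply like
  split-complex numbers.\<close>

lemma exchange_comb_mult:
  "exchange_comb k a b * exchange_comb k c d = exchange_comb k (a * c + b * d) (a * d + b * c)"
  (is "?L = ?R")
proof (rule eq_matI)
  fix i j assume "i < dim_row ?R" "j < dim_col ?R"
  then have "i < k" "j < k"
    by (simp_all add: exchange_comb_def)
  then show "?L $$ (i, j) = ?R $$ (i, j)"
    by (subst index_mult_exchange_comb[OF exchange_comb_carrier])
      (auto simp: exchange_comb_def algebra_simps)
qed (simp_all add: exchange_comb_def)

lemma det_exchange_comb_diag: "det (exchange_comb k a 0) = a ^ k"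
proof -
  have "exchange_comb k a 0 = a \<cdot>\<^sub>m 1\<^sub>m k"
    by (rule eq_matI) (auto simp: exchange_comb_def)
  then show ?thesis
    by simp
qed

lemma det_exchange_comb_mult:
  "det (exchange_comb k a b) * det (exchange_comb k c d)
   = det (exchange_comb k (a * c + b * d) (a * d + b * c))"
  unfolding exchange_comb_mult[symmetric]
  by (rule det_mult[symmetric, OF exchange_comb_carrier exchange_comb_carrier])

text \<open>
  The determinant is nonzero because \<open>(a I + b J)(a I - b J) = (a\<^sup>2 - b\<^sup>2) I\<close>, and nonnegative
  because \<open>a I + b J\<close> is the square of some \<open>x I + y J\<close>: take \<open>x \<plusminus> y\<close> to be the square roots
  of \<open>a \<plusminus> b\<close>.
\<close>

lemma det_exchange_comb_pos:
  assumes "\<bar>b\<bar> < a"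
  shows "det (exchange_comb k a b) > 0"
proof -
  define x where "x = (sqrt (a + b) + sqrt (a - b)) / 2"
  define y where "y = (sqrt (a + b) - sqrt (a - b)) / 2"
  have sq: "sqrt (a + b) * sqrt (a + b) = a + b" "sqrt (a - b) * sqrt (a - b) = a - b"
    using assms by auto
  have "x * x + y * y = a" "x * y + y * x = b"
    using sq by (simp_all add: x_def y_def field_simps)
  then have "det (exchange_comb k a b) = det (exchange_comb k x y) * det (exchange_comb k x y)"
    by (simp add: det_exchange_comb_mult)
  moreover have "det (exchange_comb k a b) * det (exchange_comb k a (- b)) = (a * a - b * b) ^ k"
    by (simp add: det_exchange_comb_mult det_exchange_comb_diag)
  moreover have "a * a - b * b = (a - b) * (a + b)"
    by (simp add: algebra_simps)
  then have "a * a - b * b \<noteq> 0"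
    using assms by auto
  ultimately show ?thesis
    by (metis mult_zero_left not_real_square_gt_zero power_not_zero)
qed

text \<open>Reversing coefficients sends index \<open>m\<close> to \<open>n - m\<close>. Mirroring
  column \<open>j\<close> to \<open>k - 1 - j\<close> does the same, except that it exchanges the
  two summands of an entry; the factor \<open>s\<close> repairs this because
  \<open>s * s = 1\<close>.\<close>

lemma formal_D_mat_schur_transform:
  assumes "s = 1 \<or> s = -1" and "degree f \<le> n"
  shows "formal_D_mat s (schur_transform n f) n k
       = formal_D_mat s f n k * exchange_comb k (coeff f 0) (- s * coeff f n)"
    (is "?L = ?R")
proof (rule eq_matI)
  fix i j assume "i < dim_row ?R" "j < dim_col ?R"
  then have ij: "i < k" "j < k"
    by (simp_all add: formal_D_mat_def exchange_comb_def)
  then have *: "int (k - 1 - j) = int k - 1 - int j"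
    by simp
  have "?L $$ (i, j) = icoeff (schur_transform n f) (int j - int i)
      + s * icoeff (schur_transform n f) (int i + int j + int n + 1 - int k)"
    using ij by (simp add: formal_D_mat_def)
  also have "\<dots> = (coeff f 0 * icoeff f (int j - int i)
        - coeff f n * icoeff f (int i + int n - int j))
      + s * (coeff f 0 * icoeff f (int i + int j + int n + 1 - int k)
        - coeff f n * icoeff f (int k - 1 - int i - int j))"
    unfolding icoeff_schur_transform[OF assms(2)] by (simp add: algebra_simps)
  also have "\<dots> = (icoeff f (int j - int i)
        + s * icoeff f (int i + int j + int n + 1 - int k)) * coeff f 0
      + (icoeff f (int k - 1 - int i - int j)
        + s * icoeff f (int i + int n - int j)) * (- s * coeff f n)"
    using assms(1) by (auto simp: algebra_simps)
  also have "\<dots> = ?R $$ (i, j)"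
    using ij by (subst index_mult_exchange_comb[OF formal_D_mat_carrier])
      (auto simp: formal_D_mat_def * algebra_simps)
  finally show "?L $$ (i, j) = ?R $$ (i, j)" .
qed (simp_all add: formal_D_mat_def exchange_comb_def)

text \<open>In the last row the second summand has index above \<open>n\<close> and vanishes, while
  the first survives only on the diagonal. The remaining minor keeps its entries, as they depend on
  \<open>n\<close> and \<open>k\<close> only through \<open>n - k\<close>.\<close>

lemma det_formal_D_mat_Suc:
  assumes "degree g \<le> n"
  shows "det (formal_D_mat s g (Suc n) (Suc k)) = coeff g 0 * det (formal_D_mat s g n k)"
proof -
  let ?A = "formal_D_mat s g (Suc n) (Suc k)"
  have last_row: "?A $$ (k, j) = (if j = k then coeff g 0 else 0)" if "j < Suc k" for j
    using that assms by (auto simp: formal_D_mat_def icoeff_def nat_add_distrib intro!: coeff_eq_0)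
  have "mat_delete ?A k k = formal_D_mat s g n k"
    by (rule eq_matI) (auto simp: mat_delete_def formal_D_mat_def algebra_simps)
  then have cof: "cofactor ?A k k = det (formal_D_mat s g n k)"
    by (simp add: cofactor_def)
  have "det ?A = (\<Sum>j<Suc k. ?A $$ (k, j) * cofactor ?A k j)"
    by (rule laplace_expansion_row[OF formal_D_mat_carrier]) simp
  also have "\<dots> = (\<Sum>j<Suc k. if j = k then coeff g 0 * cofactor ?A k j else 0)"
    by (rule sum.cong) (auto simp: last_row)
  also have "\<dots> = coeff g 0 * det (formal_D_mat s g n k)"
    using cof by simp
  finally show ?thesis .
qed

lemma det_formal_D_mat_schur_transform:
  assumes "s = 1 \<or> s = -1" and "degree f \<le> Suc n"
    and "\<bar>coeff f (Suc n)\<bar> < coeff f 0"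
  shows "det (formal_D_mat s f (Suc n) (Suc k)) > 0
     \<longleftrightarrow> det (formal_D_mat s (schur_transform (Suc n) f) n k) > 0"
proof -
  let ?g = "schur_transform (Suc n) f"
  have "det (formal_D_mat s f (Suc n) (Suc k))
      * det (exchange_comb (Suc k) (coeff f 0) (- s * coeff f (Suc n)))
    = coeff ?g 0 * det (formal_D_mat s ?g n k)"
    unfolding det_formal_D_mat_Suc[OF degree_schur_transform[OF assms(2)], symmetric]
      formal_D_mat_schur_transform[OF assms(1,2)]
    by (rule det_mult[symmetric, OF formal_D_mat_carrier exchange_comb_carrier])
  moreover have "det (exchange_comb (Suc k) (coeff f 0) (- s * coeff f (Suc n))) > 0"
    using assms(1,3) by (intro det_exchange_comb_pos) auto
  moreover have "coeff ?g 0 > 0"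
    by (rule coeff_0_schur_transform_pos[OF assms(2,3)])
  ultimately show ?thesis
    by (metis zero_less_mult_pos zero_less_mult_pos2 mult_pos_pos)
qed

section \<open>Determinants of orders one and two\<close>

lemma det_formal_D_mat_1:
  "det (formal_D_mat s f n 1) = coeff f 0 + s * coeff f n"
  by (subst det_single) (simp_all add: formal_D_mat_def icoeff_def)

lemma det_2x2:
  assumes A: "A \<in> carrier_mat 2 2"
  shows "det A = A $$ (0, 0) * A $$ (1, 1) - A $$ (0, 1) * A $$ (1, 0)"
proof -
  have minor: "det (mat_delete A 0 j) = mat_delete A 0 j $$ (0, 0)" for j
    using A by (intro det_single) (auto simp: mat_delete_def)
  have "det A = (\<Sum>j<2. A $$ (0, j) * cofactor A 0 j)"
    by (rule laplace_expansion_row[OF A]) simp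
  also have "\<dots> = A $$ (0, 0) * A $$ (1, 1) - A $$ (0, 1) * A $$ (1, 0)"
    using A by (simp add: numeral_2_eq_2 cofactor_def minor) (simp add: mat_delete_def)
  finally show ?thesis .
qed

lemma det_formal_D_mat_2:
  "det (formal_D_mat s f (Suc n) 2)
   = (coeff f 0 + s * coeff f n) * (coeff f 0 + s * coeff f (n + 2))
     - (coeff f 1 + s * coeff f (Suc n)) * (s * coeff f (Suc n))"
  by (subst det_2x2) (simp_all add: formal_D_mat_def icoeff_def nat_add_distrib)

definition formal_D_pos :: "real poly \<Rightarrow> nat \<Rightarrow> nat \<Rightarrow> bool" where
  "formal_D_pos f n k \<longleftrightarrow>
     det (formal_D_mat 1 f n k) > 0 \<and> det (formal_D_mat (-1) f n k) > 0"

lemma formal_D_pos_schur_transform: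
  assumes "degree f \<le> Suc n" and "\<bar>coeff f (Suc n)\<bar> < coeff f 0"
  shows "formal_D_pos f (Suc n) (Suc k) \<longleftrightarrow> formal_D_pos (schur_transform (Suc n) f) n k"
  using det_formal_D_mat_schur_transform[OF _ assms] by (simp add: formal_D_pos_def)

text \<open>In order 2 the terms linear in \<open>s\<close> cancel when the determinants for both
  signs are added, leaving twice the difference of the squares of \<open>coeff f 0\<close> and
  \<open>coeff f (Suc n)\<close>.\<close>

lemma coeff_less_if_formal_D_pos:
  assumes "degree f \<le> Suc n" and "coeff f 0 > 0"
    and "formal_D_pos f (Suc n) 1 \<or> formal_D_pos f (Suc n) 2"
  shows "\<bar>coeff f (Suc n)\<bar> < coeff f 0"
  using assms(3)
proof
  assume "formal_D_pos f (Suc n) 1"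
  then show ?thesis
    unfolding formal_D_pos_def det_formal_D_mat_1 by auto
next
  assume "formal_D_pos f (Suc n) 2"
  moreover have "coeff f (n + 2) = 0"
    using assms(1) by (intro coeff_eq_0) simp
  ultimately have "coeff f (Suc n) * coeff f (Suc n) < coeff f 0 * coeff f 0"
    unfolding formal_D_pos_def det_formal_D_mat_2 by (simp add: algebra_simps)
  then have "\<bar>coeff f (Suc n)\<bar> < \<bar>coeff f 0\<bar>"
    using abs_le_square_iff[of "coeff f 0" "coeff f (Suc n)"] by (simp add: power2_eq_square)
  then show ?thesis
    using assms(2) by simp
qed

section \<open>Expansiveness criteria\<close>

text \<open>Order 0 is included: each transform lowers \<open>k\<close> by one, and the descent ends
  at the empty determinant 1.\<close>

lemma formal_D_pos_if_expansive:
  assumes "expansive f" and "degree f \<le> n" and "coeff f 0 > 0" and "k \<le> n"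
  shows "formal_D_pos f n k"
  using assms
proof (induction n arbitrary: f k)
  case 0
  then show ?case
    by (simp add: formal_D_pos_def formal_D_mat_def)
next
  case (Suc n)
  have lt: "\<bar>coeff f (Suc n)\<bar> < coeff f 0"
    using Suc.prems by (intro expansive_coeff_less)
  show ?case
  proof (cases k)
    case 0
    then show ?thesis
      by (simp add: formal_D_pos_def formal_D_mat_def)
  next
    case (Suc l)
    have "formal_D_pos (schur_transform (Suc n) f) n l"
      using Suc Suc.prems lt
      by (intro Suc.IH)
        (auto simp: expansive_schur_transform degree_schur_transform coeff_0_schur_transform_pos)
    then show ?thesis
      using Suc formal_D_pos_schur_transform[OF Suc.prems(2) lt] by simp
  qed
qed

text \<open>A progression descending from \<open>n\<close> in steps of two ends at 1 or 2, the
  orders that bound the leading coefficient.\<close>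

lemma one_or_two_same_parity:
  assumes "n \<ge> 1"
  obtains k m :: nat where "k = 1 \<or> k = 2" and "n = k + 2 * m"
proof (cases "even n")
  case True
  then show ?thesis
    using assms that[of 2 "n div 2 - 1"] by (auto elim!: evenE)
next
  case False
  then show ?thesis
    using that[of 1 "n div 2"] by (auto elim!: oddE)
qed

text \<open>A Schur step lowers \<open>n\<close> and \<open>k\<close> together, so
  \<open>n - k\<close> stays even and the transform inherits the hypothesis.\<close>

lemma expansive_if_formal_D_pos_same_parity:
  assumes "degree f \<le> n" and "coeff f 0 > 0"
    and "\<And>k m. k \<ge> 1 \<Longrightarrow> n = k + 2 * m \<Longrightarrow> formal_D_pos f n k"
  shows "expansive f"
  using assms
proof (induction n arbitrary: f)
  case 0
  then show ?case
    by (simp add: expansive_degree_0)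
next
  case (Suc n)
  obtain k m where "k = 1 \<or> k = 2" and "Suc n = k + 2 * m"
    using one_or_two_same_parity[of "Suc n"] by auto
  then have "formal_D_pos f (Suc n) 1 \<or> formal_D_pos f (Suc n) 2"
    using Suc.prems(3)[of k m] by auto
  then have lt: "\<bar>coeff f (Suc n)\<bar> < coeff f 0"
    using Suc.prems by (intro coeff_less_if_formal_D_pos)
  have "expansive (schur_transform (Suc n) f)"
  proof (rule Suc.IH)
    show "degree (schur_transform (Suc n) f) \<le> n" "coeff (schur_transform (Suc n) f) 0 > 0"
      using Suc.prems lt by (auto simp: degree_schur_transform coeff_0_schur_transform_pos)
    show "formal_D_pos (schur_transform (Suc n) f) n k" if "n = k + 2 * m" for k m
      using Suc.prems(3)[of "Suc k" m] that formal_D_pos_schur_transform[OF Suc.prems(1) lt]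
      by simp
  qed
  then show ?case
    using expansive_schur_transform[OF Suc.prems(1) lt] by simp
qed

text \<open>The same descent, stopped at formal degree one, where no determinant condition is left
  and the values at 1 and -1 supply the coefficient bound.\<close>

lemma expansive_if_formal_D_pos_other_parity:
  assumes "degree f \<le> Suc n" and "coeff f 0 > 0" and "poly f 1 > 0" and "poly f (-1) > 0"
    and "\<And>k m. k \<ge> 1 \<Longrightarrow> n = k + 2 * m \<Longrightarrow> formal_D_pos f (Suc n) k"
  shows "expansive f"
  using assms
proof (induction n arbitrary: f)
  case 0
  have "poly f x = coeff f 0 + coeff f 1 * x" for x
  proof -
    have "degree f = 0 \<or> degree f = 1"
      using 0(1) by linarith
    then show ?thesis
      by (auto simp: poly_altdef coeff_eq_0)
  qed
  then have lt: "\<bar>coeff f (Suc 0)\<bar> < coeff f 0"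
    using 0(3,4) by simp
  have "expansive (schur_transform (Suc 0) f)"
    using 0(1) lt degree_schur_transform[of f 0]
    by (intro expansive_degree_0) (simp_all add: coeff_0_schur_transform_pos)
  then show ?case
    using expansive_schur_transform[OF 0(1) lt] by simp
next
  case (Suc n)
  obtain k m where "k = 1 \<or> k = 2" and "Suc n = k + 2 * m"
    using one_or_two_same_parity[of "Suc n"] by auto
  then have "formal_D_pos f (Suc (Suc n)) 1 \<or> formal_D_pos f (Suc (Suc n)) 2"
    using Suc.prems(5)[of k m] by auto
  then have lt: "\<bar>coeff f (Suc (Suc n))\<bar> < coeff f 0"
    using Suc.prems by (intro coeff_less_if_formal_D_pos)
  let ?g = "schur_transform (Suc (Suc n)) f"
  have "expansive ?g"
  proof (rule Suc.IH)
    show "degree ?g \<le> Suc n"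
      using Suc.prems(1) by (rule degree_schur_transform)
    show "coeff ?g 0 > 0"
      using Suc.prems(1) lt by (rule coeff_0_schur_transform_pos)
    show "poly ?g 1 > 0" "poly ?g (-1) > 0"
      using Suc.prems(1,3,4) lt by (auto intro!: poly_schur_transform_pos)
    show "formal_D_pos ?g (Suc n) k" if "n = k + 2 * m" for k m
      using Suc.prems(5)[of "Suc k" m] that formal_D_pos_schur_transform[OF Suc.prems(1) lt]
      by simp
  qed
  then show ?case
    using expansive_schur_transform[OF Suc.prems(1) lt] by simp
qed

theorem theorem3p2:
  fixes f :: "real poly" and n :: nat
  assumes "degree f = n" and "n \<ge> 1" and "coeff f 0 > 0"
  shows "(expansive f \<longleftrightarrow>
           (\<forall>k\<in>{1..n}. D_plus k f > 0 \<and> D_minus k f > 0))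
    \<and> (expansive f \<longleftrightarrow>
           (\<forall>k\<in>{1..n-1}. D_plus k f > 0 \<and> D_minus k f > 0)
           \<and> poly f 1 > 0 \<and> poly f (-1) > 0)
    \<and> (expansive f \<longleftrightarrow>
           (\<forall>k\<ge>1. (\<exists>m. n = k + 2 * m) \<longrightarrow> D_plus k f > 0 \<and> D_minus k f > 0))
    \<and> (expansive f \<longleftrightarrow>
           (\<forall>k\<ge>1. (\<exists>m. n - 1 = k + 2 * m) \<longrightarrow> D_plus k f > 0 \<and> D_minus k f > 0)
           \<and> poly f 1 > 0 \<and> poly f (-1) > 0)"
proof -
  have D: "D_plus k f > 0 \<and> D_minus k f > 0 \<longleftrightarrow> formal_D_pos f n k" for k
    using assms(1) by (simp add: D_plus_def D_minus_def D_mat_eq_formal formal_D_pos_def)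
  have pos: "formal_D_pos f n k" if "expansive f" "k \<le> n" for k
    using formal_D_pos_if_expansive that assms by simp
  have ends: "poly f 1 > 0 \<and> poly f (-1) > 0" if "expansive f"
    using expansive_poly_pos that assms(3) by blast
  have same: "expansive f" if "\<And>k m. k \<ge> 1 \<Longrightarrow> n = k + 2 * m \<Longrightarrow> formal_D_pos f n k"
    using expansive_if_formal_D_pos_same_parity[of f n] that assms by blast
  have n: "n = Suc (n - 1)"
    using assms(2) by simp
  have other: "expansive f" if "\<And>k m. k \<ge> 1 \<Longrightarrow> n - 1 = k + 2 * m \<Longrightarrow> formal_D_pos f n k"
    "poly f 1 > 0" "poly f (-1) > 0"
    using expansive_if_formal_D_pos_other_parity[of f "n - 1", folded n] that assms by blast
  \<comment> \<open>The full ranges of \<open>k\<close> contain the alternating ones, so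
    \<open>same\<close> and \<open>other\<close> give all four converses; \<open>pos\<close> and
    \<open>ends\<close> settle the forward directions.\<close>
  show ?thesis
    unfolding D
  proof (intro conjI iffI ballI allI impI)
    assume *: "\<forall>k\<in>{1..n}. formal_D_pos f n k"
    show "expansive f"
      by (rule same) (use * in auto)
  next
    assume *: "(\<forall>k\<in>{1..n-1}. formal_D_pos f n k) \<and> poly f 1 > 0 \<and> poly f (-1) > 0"
    show "expansive f"
      by (rule other) (use * in auto)
  next
    assume *: "\<forall>k\<ge>1. (\<exists>m. n = k + 2 * m) \<longrightarrow> formal_D_pos f n k"
    show "expansive f"
      by (rule same) (use * in auto)
  next
    assume *: "(\<forall>k\<ge>1. (\<exists>m. n - 1 = k + 2 * m) \<longrightarrow> formal_D_pos f n k)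
      \<and> poly f 1 > 0 \<and> poly f (-1) > 0"
    show "expansive f"
      by (rule other) (use * in auto)
  qed (use pos ends in auto)
qed

end
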